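(* Let $f\colon\mathbb{R}^n\to\mathbb{R}$ and $G\colon\mathbb{R}^n\to\mathbb{S}^m$ be continuously differentiable, and consider the problem of minimizing $f(x)$ subject to $G(x)\succeq 0$. Every local minimizer $\bar{x}$ of this problem that satisfies weak-Robinson's CQ also satisfies the KKT conditions. By extension, every local minimizer $\bar{x}$ that satisfies weak-nondegeneracy also satisfies the KKT conditions.
   Context: $\mathbb{S}^m$ is the space of real symmetric $m\times m$ matrices with inner product $\langle M,N\rangle=\operatorname{trace}(MN)$; $M\succeq 0$ means that $M$ is positive semidefinite. The feasible set is $\mathcal{F}=\{x\in\mathbb{R}^n : G(x)\succeq 0\}$. For $x\in\mathbb{R}^n$, $D_{x_\ell}G(x)\in\mathbb{S}^m$ are the partial derivatives of $G$, and $DG(x)^*\colon\mathbb{S}^m\to\mathbb{R}^n$ is the adjoint of the derivative, $DG(x)^*[M]=(\langle D_{x_1}G(x),M\rangle,\ldots,\langle D_{x_n}G(x),M\rangle)^\top$. KKT conditions: $\bar{x}\in\mathcal{F}$ satisfies the KKT conditions if there exists $\bar{Y}\succeq 0$ in $\mathbb{S}^m$ such that $\nabla f(\bar{x})-DG(\bar{x})^*[\bar{Y}]=0$ and $\langle G(\bar{x}),\bar{Y}\rangle=0$. For $\bar{x}\in\mathcal{F}$ with $r=\operatorname{rank}(G(\bar{x}))$ and a matrix $\bar{E}\in\mathbb{R}^{m\times(m-r)}$ with columns $\bar{e}_1,\ldots,\bar{e}_{m-r}$, set $v_{ij}(\bar{x},\bar{E})=[\bar{e}_i^\top D_{x_1}G(\bar{x})\bar{e}_j,\ldots,\bar{e}_i^\top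 D_{x_n}G(\bar{x})\bar{e}_j]^\top\in\mathbb{R}^n$. Weak-nondegeneracy (respectively, weak-Robinson's CQ) holds at $\bar{x}\in\mathcal{F}$ if either $\operatorname{Ker}G(\bar{x})=\{0\}$ or: for every sequence $\{x^k\}_{k\in\mathbb{N}}\to\bar{x}$ there exists a sequence of matrices with orthonormal columns $\{E^k\}_{k\in\mathbb{N}}\subseteq\mathbb{R}^{m\times(m-r)}$ such that (1) the columns of $E^k$ are eigenvectors associated with the $m-r$ smallest eigenvalues (counted with multiplicity) of $G(x^k)$, for each $k\in\mathbb{N}$; and (2) there exists a limit point (i.e. the limit of some subsequence) $\bar{E}$ of $\{E^k\}$ such that the family $\{v_{ii}(\bar{x},\bar{E}) : i\in\{1,\ldots,m-r\}\}$ is linearly independent (respectively, positive linearly independent). A family of vectors $w_1,\ldots,w_p$ (indexed, so repetitions count) is positive linearly independent if $\sum_i\alpha_iw_i=0$ with all $\alpha_i\ge0$ implies that all $\alpha_i=0$. *)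

theory Defs
  imports "HOL-Analysis.Analysis"
begin

section \<open>Symmetric matrices\<close>

definition symmetric_matrix :: "real^'m^'m \<Rightarrow> bool"
  where "symmetric_matrix M \<longleftrightarrow> transpose M = M"

definition psd :: "real^'m^'m \<Rightarrow> bool"
  where "psd M \<longleftrightarrow> symmetric_matrix M \<and> (\<forall>v. 0 \<le> v \<bullet> (M *v v))"

definition trace_inner :: "real^'m^'m \<Rightarrow> real^'m^'m \<Rightarrow> real"
  where "trace_inner M N = trace (M ** N)"

definition spectrum :: "real^'m^'m \<Rightarrow> real set"
  where "spectrum M = {c. \<exists>v. v \<noteq> 0 \<and> M *v v = c *\<^sub>R v}"

text \<open>
  The eigenvalues of \<open>M\<close> in nondecreasing order, each repeated according to the dimension of its
  eigenspace. The geometric multiplicity is the right one because \<open>M\<close> is meant to be symmetric; the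
  list then has length \<open>CARD('m)\<close>.
\<close>

definition eigenvalue_list :: "real^'m^'m \<Rightarrow> real list"
  where "eigenvalue_list M =
    sorted_list_of_multiset (\<Sum>c\<in>spectrum M. replicate_mset (dim {v. M *v v = c *\<^sub>R v}) c)"

text \<open>
  A matrix with \<open>p\<close> columns, where \<open>p\<close> depends on a point and so cannot be a type, is represented by
  its family of columns \<open>E 0, \<dots>, E (p - 1)\<close>; values at other indices are irrelevant.
\<close>

definition orthonormal_columns :: "nat \<Rightarrow> (nat \<Rightarrow> real^'m) \<Rightarrow> bool"
  where "orthonormal_columns p E \<longleftrightarrow> (\<forall>i<p. \<forall>j<p. E i \<bullet> E j = (if i = j then 1 else 0))"

text \<open>
  The columns may be matched with the \<open>p\<close> smallest eigenvalues in any order. This predicate is only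
  used together with \<^const>\<open>orthonormal_columns\<close>, so the columns are nonzero.
\<close>

definition smallest_eigenvectors :: "real^'m^'m \<Rightarrow> nat \<Rightarrow> (nat \<Rightarrow> real^'m) \<Rightarrow> bool"
  where "smallest_eigenvectors M p E \<longleftrightarrow>
    (\<exists>\<pi>. \<pi> permutes {..<p} \<and> (\<forall>i<p. M *v E i = (eigenvalue_list M ! \<pi> i) *\<^sub>R E i))"


section \<open>Derivatives\<close>

definition continuously_differentiable :: "('a::real_normed_vector \<Rightarrow> 'b::real_normed_vector) \<Rightarrow> bool"
  where "continuously_differentiable g \<longleftrightarrow>
    (\<exists>g' :: 'a \<Rightarrow> 'a \<Rightarrow>\<^sub>L 'b.
      (\<forall>x. (g has_derivative blinfun_apply (g' x)) (at x)) \<and> continuous_on UNIV g')"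

definition partial_derivative :: "'n \<Rightarrow> (real^'n \<Rightarrow> 'b::real_normed_vector) \<Rightarrow> real^'n \<Rightarrow> 'b"
  where "partial_derivative l g x = vector_derivative (\<lambda>t. g (x + t *\<^sub>R axis l 1)) (at 0)"

definition gradient :: "(real^'n \<Rightarrow> real) \<Rightarrow> real^'n \<Rightarrow> real^'n"
  where "gradient f x = (\<chi> l. partial_derivative l f x)"

definition adjoint_derivative :: "(real^'n \<Rightarrow> real^'m^'m) \<Rightarrow> real^'n \<Rightarrow> real^'m^'m \<Rightarrow> real^'n"
  where "adjoint_derivative G x M = (\<chi> l. trace_inner (partial_derivative l G x) M)"


section \<open>The optimization problem\<close>

definition feasible_set :: "(real^'n \<Rightarrow> real^'m^'m) \<Rightarrow> (real^'n) set"
  where "feasible_set G = {x. psd (G x)}"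

definition local_minimizer :: "(real^'n \<Rightarrow> real) \<Rightarrow> (real^'n \<Rightarrow> real^'m^'m) \<Rightarrow> real^'n \<Rightarrow> bool"
  where "local_minimizer f G xbar \<longleftrightarrow>
    xbar \<in> feasible_set G \<and>
    (\<exists>\<epsilon>>0. \<forall>x \<in> feasible_set G \<inter> ball xbar \<epsilon>. f xbar \<le> f x)"

definition KKT :: "(real^'n \<Rightarrow> real) \<Rightarrow> (real^'n \<Rightarrow> real^'m^'m) \<Rightarrow> real^'n \<Rightarrow> bool"
  where "KKT f G xbar \<longleftrightarrow>
    xbar \<in> feasible_set G \<and>
    (\<exists>Y. psd Y \<and> gradient f xbar - adjoint_derivative G xbar Y = 0 \<and>
         trace_inner (G xbar) Y = 0)"


section \<open>Constraint qualifications\<close>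

text \<open>
  Both notions concern the indexed family \<open>w 0, \<dots>, w (p - 1)\<close>, so repeated vectors count
  (unlike for \<^const>\<open>independent\<close>, which is about sets).
\<close>

definition lin_indep_family :: "nat \<Rightarrow> (nat \<Rightarrow> 'a::real_vector) \<Rightarrow> bool"
  where "lin_indep_family p w \<longleftrightarrow>
    (\<forall>\<alpha>::nat \<Rightarrow> real. (\<Sum>i<p. \<alpha> i *\<^sub>R w i) = 0 \<longrightarrow> (\<forall>i<p. \<alpha> i = 0))"

definition pos_lin_indep_family :: "nat \<Rightarrow> (nat \<Rightarrow> 'a::real_vector) \<Rightarrow> bool"
  where "pos_lin_indep_family p w \<longleftrightarrow>
    (\<forall>\<alpha>::nat \<Rightarrow> real.
      (\<forall>i<p. 0 \<le> \<alpha> i) \<and> (\<Sum>i<p. \<alpha> i *\<^sub>R w i) = 0 \<longrightarrow> (\<forall>i<p. \<alpha> i = 0))"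

definition v_vec :: "(real^'n \<Rightarrow> real^'m^'m) \<Rightarrow> real^'n \<Rightarrow> (nat \<Rightarrow> real^'m) \<Rightarrow> nat \<Rightarrow> nat \<Rightarrow> real^'n"
  where "v_vec G x E i j = (\<chi> l. E i \<bullet> (partial_derivative l G x *v E j))"

definition weak_cq ::
  "(nat \<Rightarrow> (nat \<Rightarrow> real^'n) \<Rightarrow> bool) \<Rightarrow> (real^'n \<Rightarrow> real^'m^'m) \<Rightarrow> real^'n \<Rightarrow> bool"
  where "weak_cq indep G xbar \<longleftrightarrow>
    xbar \<in> feasible_set G \<and>
    (let p = CARD('m) - rank (G xbar) in
      {v. G xbar *v v = 0} = {0} \<or>
      (\<forall>x :: nat \<Rightarrow> real^'n. x \<longlonglongrightarrow> xbar \<longrightarrow>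
        (\<exists>E :: nat \<Rightarrow> nat \<Rightarrow> real^'m.
          (\<forall>k. orthonormal_columns p (E k)) \<and>
          (\<forall>k. smallest_eigenvectors (G (x k)) p (E k)) \<and>
          (\<exists>Ebar \<phi>. strict_mono \<phi> \<and> (\<forall>i<p. (\<lambda>k. E (\<phi> k) i) \<longlonglongrightarrow> Ebar i) \<and>
                  indep p (\<lambda>i. v_vec G xbar Ebar i i)))))"

definition weak_nondegeneracy :: "(real^'n \<Rightarrow> real^'m^'m) \<Rightarrow> real^'n \<Rightarrow> bool"
  where "weak_nondegeneracy = weak_cq lin_indep_family"

definition weak_Robinson :: "(real^'n \<Rightarrow> real^'m^'m) \<Rightarrow> real^'n \<Rightarrow> bool"
  where "weak_Robinson = weak_cq pos_lin_indep_family"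

end

theory Submission
  imports Defs
begin

text \<open>
  Quadratic penalization of the distance from \<open>G x\<close> to the semidefinite cone gives points \<open>x k\<close>
  converging to \<open>xbar\<close> and multipliers \<open>Y k\<close> that satisfy the KKT conditions approximately. Divide
  them by \<open>1 + norm (Y k)\<close> and pass to the limit: this is a Fritz John condition, with a nonnegative
  coefficient \<open>t\<close> of the gradient of \<open>f\<close> and a limit multiplier \<open>W\<close> annihilating \<open>G xbar\<close>. Since \<open>Y k\<close>
  has the eigenvectors of \<open>G (x k)\<close>, the limiting columns \<open>Ebar\<close> diagonalize \<open>W\<close>, and they span the
  kernel of \<open>G xbar\<close>. If \<open>t = 0\<close>, the stationarity equation is therefore a nonnegative linear relation
  among the \<open>v_vec G xbar Ebar i i\<close>, so \<open>W = 0\<close>, contradicting \<open>t + norm W = 1\<close>.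
\<close>

section \<open>Symmetric and positive semidefinite matrices\<close>

lemma symmetric_matrix_inner:
  assumes "symmetric_matrix M"
  shows "(M *v u) \<bullet> w = u \<bullet> (M *v w)"
  by (metis assms dot_lmul_matrix symmetric_matrix_def transpose_matrix_vector)

lemma inner_matrix_trace: "M \<bullet> N = trace (transpose M ** N)" for M N :: "real^'m^'n"
proof -
  have "trace (transpose M ** N) = (\<Sum>i\<in>UNIV. \<Sum>k\<in>UNIV. M $ k $ i * N $ k $ i)"
    by (simp add: trace_def matrix_matrix_mult_def transpose_def)
  also have "\<dots> = (\<Sum>k\<in>UNIV. \<Sum>i\<in>UNIV. M $ k $ i * N $ k $ i)"
    by (rule sum.swap)
  finally show ?thesis by (simp add: inner_vec_def)
qed

text \<open>Links the trace form used in the KKT conditions to the Euclidean inner product on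
  matrices, for which the nearest-point theory is available.\<close>

lemma trace_inner_symmetric:
  assumes "symmetric_matrix N"
  shows "trace_inner M N = M \<bullet> N"
  using assms by (metis inner_commute inner_matrix_trace symmetric_matrix_def trace_inner_def trace_mul_sym)

section \<open>Limits of matrix operations; the semidefinite cone is closed and convex\<close>

lemma tendsto_matrix_vector_mult:
  fixes A :: "'a \<Rightarrow> real^'n^'m"
  assumes "(A \<longlongrightarrow> L) F" "(v \<longlongrightarrow> w) F"
  shows "((\<lambda>k. A k *v v k) \<longlongrightarrow> L *v w) F"
  unfolding matrix_vector_mult_def
  by (intro vec_tendstoI) (simp, intro tendsto_intros assms)

lemma tendsto_matrix_matrix_mult:
  fixes A :: "'a \<Rightarrow> real^'n^'m" and B :: "'a \<Rightarrow> real^'k^'n"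
  assumes "(A \<longlongrightarrow> L) F" "(B \<longlongrightarrow> M) F"
  shows "((\<lambda>k. A k ** B k) \<longlongrightarrow> L ** M) F"
  unfolding matrix_matrix_mult_def
  by (intro vec_tendstoI) (simp, intro tendsto_intros assms)

lemma tendsto_transpose:
  fixes A :: "'a \<Rightarrow> real^'n^'m"
  assumes "(A \<longlongrightarrow> L) F"
  shows "((\<lambda>k. transpose (A k)) \<longlongrightarrow> transpose L) F"
  unfolding transpose_def
  by (intro vec_tendstoI) (simp, intro tendsto_intros assms)

lemma psd_limit:
  assumes "\<And>k. psd (A k)" and "A \<longlonglongrightarrow> L"
  shows "psd L"
  unfolding psd_def
proof (intro conjI allI)
  have "(\<lambda>k. transpose (A k)) \<longlonglongrightarrow> L"
    using assms by (simp add: psd_def symmetric_matrix_def)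
  with tendsto_transpose[OF assms(2)] show "symmetric_matrix L"
    unfolding symmetric_matrix_def by (rule LIMSEQ_unique)
  fix v
  have "(\<lambda>k. v \<bullet> (A k *v v)) \<longlonglongrightarrow> v \<bullet> (L *v v)"
    by (intro tendsto_intros tendsto_matrix_vector_mult assms)
  then show "0 \<le> v \<bullet> (L *v v)"
    by (rule LIMSEQ_le_const) (use assms(1) in \<open>auto simp: psd_def\<close>)
qed

lemma closed_psd: "closed {M. psd M}"
  unfolding closed_sequential_limits using psd_limit by auto

lemma psd_0: "psd 0"
  by (simp add: psd_def symmetric_matrix_def transpose_def vec_eq_iff)

lemma symmetric_matrix_scaleR: "symmetric_matrix A \<Longrightarrow> symmetric_matrix (c *\<^sub>R A)"
  by (simp add: symmetric_matrix_def transpose_def vec_eq_iff)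

lemma symmetric_matrix_add: "symmetric_matrix A \<Longrightarrow> symmetric_matrix B \<Longrightarrow> symmetric_matrix (A + B)"
  by (simp add: symmetric_matrix_def transpose_def vec_eq_iff)

lemma symmetric_matrix_diff: "symmetric_matrix A \<Longrightarrow> symmetric_matrix B \<Longrightarrow> symmetric_matrix (A - B)"
  by (simp add: symmetric_matrix_def transpose_def vec_eq_iff)

lemma psd_scaleR: "psd A \<Longrightarrow> 0 \<le> c \<Longrightarrow> psd (c *\<^sub>R A)"
  by (simp add: psd_def symmetric_matrix_scaleR scaleR_matrix_vector_assoc[symmetric])

lemma psd_add: "psd A \<Longrightarrow> psd B \<Longrightarrow> psd (A + B)"
  by (simp add: psd_def symmetric_matrix_add matrix_vector_mult_add_rdistrib inner_add_right)

lemma convex_psd: "convex {M. psd M}"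
  by (auto simp: convex_def psd_scaleR psd_add)

text \<open>The quadratic form at \<open>v\<close> is that of \<open>P\<close> at
  \<open>transpose B *v v\<close>.\<close>

lemma psd_congruence:
  fixes B P :: "real^'m^'m"
  assumes "psd P"
  shows "psd (B ** P ** transpose B)"
  unfolding psd_def
proof (intro conjI allI)
  show "symmetric_matrix (B ** P ** transpose B)"
    using assms by (simp add: psd_def symmetric_matrix_def matrix_transpose_mul matrix_mul_assoc)
  fix v
  have "v \<bullet> ((B ** P ** transpose B) *v v) = v \<bullet> (B *v (P *v (transpose B *v v)))"
    by (simp only: matrix_vector_mul_assoc matrix_mul_assoc)
  also have "\<dots> = (transpose B *v v) \<bullet> (P *v (transpose B *v v))"
    by (metis dot_lmul_matrix transpose_matrix_vector)
  finally show "0 \<le> v \<bullet> ((B ** P ** transpose B) *v v)"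
    using assms by (metis psd_def)
qed

lemma outer_product_vector_mult: "(\<chi> i j. v $ i * v $ j) *v w = (v \<bullet> w) *\<^sub>R v"
  for v :: "real^'m"
  by (simp add: matrix_vector_mult_def inner_vec_def vec_eq_iff sum_distrib_right sum_distrib_left mult_ac)

text \<open>The matrix is the rank-one product of \<open>v\<close> with its transpose. Pairing with
  it evaluates a quadratic form, which yields self-duality of the cone and later the spectral
  decomposition of the limit multiplier.\<close>

lemma psd_outer_product: "psd (\<chi> i j. v $ i * v $ j)" (is "psd ?Q")
  and inner_outer_product: "M \<bullet> (\<chi> i j. v $ i * v $ j) = v \<bullet> (M *v v)"
  for v :: "real^'m"
proof -
  show "psd ?Q"
    unfolding psd_def outer_product_vector_mult by (auto simp: symmetric_matrix_def transpose_def vec_eq_iff inner_commute)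
  show "M \<bullet> ?Q = v \<bullet> (M *v v)"
    by (simp add: matrix_vector_mult_def inner_vec_def sum_distrib_left mult_ac)
qed

text \<open>First-order condition at the minimum \<open>t = 0\<close>: near 0 a nonzero linear term
  dominates the quadratic one and takes both signs.\<close>

lemma quadratic_nonneg_imp_linear_zero:
  fixes b c :: real
  assumes "\<And>t. 0 \<le> t * b + t\<^sup>2 * c"
  shows "b = 0"
proof (rule ccontr)
  assume "b \<noteq> 0"
  \<comment> \<open>This choice makes \<open>b + t * \<bar>c\<bar>\<close> equal to
    \<open>- t\<close>, so the upper bound collapses to minus the square of
    \<open>t\<close>.\<close>
  define t where "t = - b / (\<bar>c\<bar> + 1)"
  have "t * b + t\<^sup>2 * c \<le> t * b + t\<^sup>2 * \<bar>c\<bar>"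
    by (intro add_left_mono mult_left_mono) auto
  also have "\<dots> = - t\<^sup>2"
  proof -
    have "b = - t * (\<bar>c\<bar> + 1)"
      by (simp add: t_def)
    then have "b + t * \<bar>c\<bar> = - t"
      by (simp add: algebra_simps)
    moreover have "t * b + t\<^sup>2 * \<bar>c\<bar> = t * (b + t * \<bar>c\<bar>)"
      by (simp add: algebra_simps power2_eq_square)
    ultimately show ?thesis
      by (simp add: power2_eq_square)
  qed
  also have "\<dots> < 0"
    using \<open>b \<noteq> 0\<close> by (simp add: t_def)
  finally show False
    using assms[of t] by simp
qed

section \<open>Complementarity and projection onto the semidefinite cone\<close>

lemma matrix_add_rdistrib: "(A + B) ** C = A ** C + B ** C" for A B :: "'a::semiring_1^'n^'m"
  by (vector matrix_matrix_mult_def sum.distrib[symmetric] distrib_right)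

text \<open>
  The products vanish because \<open>(I + tA) P (I + tA)\<^sup>T\<close> is positive semidefinite for all \<open>t\<close>, so its
  inner product with \<open>Y\<close> is minimal at \<open>t = 0\<close>; take \<open>A = YP\<close>.
\<close>

lemma psd_complementary_mult_zero:
  assumes P: "psd P" and Y: "symmetric_matrix Y"
    and pos: "\<And>Q. psd Q \<Longrightarrow> 0 \<le> Y \<bullet> Q" and zero: "Y \<bullet> P = 0"
  shows "Y ** P = 0"
proof -
  have tr: "transpose P = P" "transpose Y = Y"
    using P Y by (auto simp: psd_def symmetric_matrix_def)
  have "0 \<le> t * (Y \<bullet> (Y ** P ** P + P ** P ** Y)) + t\<^sup>2 * (Y \<bullet> (Y ** P ** P ** P ** Y))" for t
  proof -
    define B where "B = mat 1 + t *\<^sub>R (Y ** P)"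
    have "transpose B = mat 1 + t *\<^sub>R (P ** Y)"
    proof -
      have "transpose B = transpose (mat 1) + t *\<^sub>R transpose (Y ** P)"
        by (simp add: B_def transpose_def vec_eq_iff)
      then show ?thesis by (simp add: matrix_transpose_mul tr transpose_mat)
    qed
    then have "B ** P ** transpose B =
        P + t *\<^sub>R (Y ** P ** P + P ** P ** Y) + t\<^sup>2 *\<^sub>R (Y ** P ** P ** P ** Y)"
      by (simp add: B_def matrix_add_ldistrib matrix_add_rdistrib matrix_scalar_ac scalar_matrix_assoc[symmetric]
          matrix_mul_assoc scaleR_add_right power2_eq_square)
    then show ?thesis
      using pos[OF psd_congruence[OF P, of B]] zero by (simp add: inner_add_right)
  qed
  then have "Y \<bullet> (Y ** P ** P + P ** P ** Y) = 0"
    by (rule quadratic_nonneg_imp_linear_zero)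
  \<comment> \<open>The vanishing linear coefficient is the sum of the squared norms of
    \<open>Y ** P\<close> and \<open>P ** Y\<close>.\<close>
  moreover have "Y \<bullet> (Y ** P ** P) = (Y ** P) \<bullet> (Y ** P)"
    unfolding inner_matrix_trace matrix_transpose_mul tr
    by (metis matrix_mul_assoc trace_mul_sym)
  moreover have "Y \<bullet> (P ** P ** Y) = (P ** Y) \<bullet> (P ** Y)"
    unfolding inner_matrix_trace matrix_transpose_mul tr
    by (simp add: matrix_mul_assoc)
  ultimately have "(Y ** P) \<bullet> (Y ** P) = 0"
    by (smt (verit) inner_add_right inner_ge_zero)
  then show ?thesis by simp
qed

text \<open>Moreau decomposition: with \<open>P\<close> the nearest point of the cone,
  \<open>M\<close> is the difference of the complementary semidefinite matrices \<open>P\<close> and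
  \<open>P - M\<close>. Everything follows from the variational inequality at
  \<open>P\<close>.\<close>

lemma psd_projection:
  fixes M :: "real^'m^'m"
  assumes "symmetric_matrix M"
  obtains P where "psd P" "dist M P = infdist M {M. psd M}" "psd (P - M)" "(P - M) ** P = 0"
proof -
  have ne: "{M::real^'m^'m. psd M} \<noteq> {}" using psd_0 by blast
  obtain P where P: "psd P" and d: "infdist M {M. psd M} = dist M P"
    using infdist_attains_inf[OF closed_psd ne] by blast
  have var: "(M - P) \<bullet> (Q - P) \<le> 0" if "psd Q" for Q
  proof (rule any_closest_point_dot[OF convex_psd closed_psd])
    show "\<forall>z\<in>{M. psd M}. dist M P \<le> dist M z"
      by (metis d infdist_le)
  qed (use P that in auto)
  \<comment> \<open>Testing with 0 and with \<open>2 *\<^sub>R P\<close> moves along the ray through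
    \<open>P\<close> in both directions.\<close>
  have zero: "(P - M) \<bullet> P = 0"
    using var[OF psd_0] var[OF psd_scaleR[OF P, of 2]]
    by (simp add: inner_diff_left inner_diff_right)
  have pos: "0 \<le> (P - M) \<bullet> Q" if "psd Q" for Q
    using var[OF that] zero by (simp add: inner_diff_left inner_diff_right)
  have sym: "symmetric_matrix (P - M)"
    using P assms by (simp add: psd_def symmetric_matrix_diff)
  \<comment> \<open>Rank-one test matrices turn nonnegativity on the cone into
    semidefiniteness.\<close>
  have "psd (P - M)"
    unfolding psd_def using sym pos[OF psd_outer_product] by (simp add: inner_outer_product)
  with that[OF P] d show thesis
    by (simp add: psd_complementary_mult_zero[OF P sym pos zero])
qed

text \<open>Complementary matrices annihilate each other, so \<open>e\<close> is killed by
  \<open>P\<close> if \<open>c < 0\<close> and by \<open>Y\<close> otherwise. The eigenvalue is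
  written as a Rayleigh quotient so that the identity passes to limits.\<close>

lemma eigenvector_of_psd_part:
  assumes P: "psd P" and Y: "psd Y" and YP: "Y ** P = 0"
    and e: "(P - Y) *v e = c *\<^sub>R e" "norm e = 1"
  shows "Y *v e = (e \<bullet> (Y *v e)) *\<^sub>R e"
proof -
  have sym: "symmetric_matrix P" "symmetric_matrix Y"
    using P Y by (auto simp: psd_def)
  then have "P ** Y = 0"
    using YP by (metis matrix_transpose_mul symmetric_matrix_def psd_0 psd_def)
  have eq: "P *v e = Y *v e + c *\<^sub>R e"
    using e(1) by (simp add: matrix_vector_mult_diff_rdistrib algebra_simps)
  have Pe: "P *v (P *v e) = c *\<^sub>R (P *v e)"
    by (subst eq) (simp add: matrix_vector_right_distrib matrix_vector_mult_scaleR
        matrix_vector_mul_assoc \<open>P ** Y = 0\<close>)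
  have Ye: "Y *v (Y *v e) = - c *\<^sub>R (Y *v e)"
  proof -
    have "0 = Y *v (P *v e)" by (simp add: matrix_vector_mul_assoc YP)
    also have "\<dots> = Y *v (Y *v e) + c *\<^sub>R (Y *v e)"
      by (simp add: eq matrix_vector_right_distrib matrix_vector_mult_scaleR)
    finally show ?thesis by (simp add: eq_neg_iff_add_eq_0)
  qed
  show ?thesis
  proof (cases "c < 0")
    case True
    \<comment> \<open>\<open>Pe\<close> makes the squared norm of \<open>P *v e\<close> a negative
      multiple of a nonnegative number; the other case treats \<open>Y *v e\<close> with the
      opposite sign.\<close>
    have "(P *v e) \<bullet> (P *v e) = c * (e \<bullet> (P *v e))"
      using symmetric_matrix_inner[OF sym(1), of e "P *v e"] by (simp add: Pe)
    also have "\<dots> \<le> 0"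
      using True P by (simp add: psd_def mult_nonpos_nonneg)
    finally have "P *v e = 0"
      by (metis inner_eq_zero_iff inner_ge_zero order_antisym)
    with eq have "Y *v e = (- c) *\<^sub>R e"
      by (simp add: eq_neg_iff_add_eq_0)
    then show ?thesis
      using e(2) by (simp add: norm_eq_1)
  next
    case False
    have "(Y *v e) \<bullet> (Y *v e) = - (c * (e \<bullet> (Y *v e)))"
      using symmetric_matrix_inner[OF sym(2), of e "Y *v e"] by (simp add: Ye)
    also have "\<dots> \<le> 0"
      using False Y by (simp add: psd_def)
    finally have "Y *v e = 0"
      by (metis inner_eq_zero_iff inner_ge_zero order_antisym)
    then show ?thesis by simp
  qed
qed

section \<open>Spectral theory\<close>

text \<open>A minimizer of the quadratic form on the compact unit sphere of \<open>S\<close> is an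
  eigenvector, and homogeneity extends the bound to all of \<open>S\<close>.\<close>

lemma eigenvector_minimizing_Rayleigh:
  fixes M :: "real^'m^'m"
  assumes M: "symmetric_matrix M" and S: "subspace S" "S \<noteq> {0}"
    and inv: "\<And>v. v \<in> S \<Longrightarrow> M *v v \<in> S"
  obtains v c where "v \<in> S" "v \<noteq> 0" "M *v v = c *\<^sub>R v"
    "\<And>u. u \<in> S \<Longrightarrow> c * (u \<bullet> u) \<le> u \<bullet> (M *v u)"
proof -
  define K where "K = S \<inter> sphere 0 1"
  obtain s where s: "s \<in> S" "s \<noteq> 0"
    using S subspace_0 by blast
  then have "(1 / norm s) *\<^sub>R s \<in> K"
    using S(1) by (simp add: K_def subspace_scale)
  then have "K \<noteq> {}" by blast
  moreover have "compact K"
    unfolding K_def using closed_subspace[OF S(1)] by (simp add: closed_Int_compact)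
  moreover have "continuous_on K (\<lambda>v. v \<bullet> (M *v v))"
    by (intro continuous_intros linear_continuous_on matrix_vector_mul_bounded_linear)
  ultimately obtain v where v: "v \<in> K" and min: "\<And>u. u \<in> K \<Longrightarrow> v \<bullet> (M *v v) \<le> u \<bullet> (M *v u)"
    using continuous_attains_inf by metis
  define c where "c = v \<bullet> (M *v v)"
  have vS: "v \<in> S" and v1: "norm v = 1"
    using v by (auto simp: K_def)
  have ray: "c * (u \<bullet> u) \<le> u \<bullet> (M *v u)" if "u \<in> S" for u
  proof (cases "u = 0")
    case False
    have "(1 / norm u) *\<^sub>R u \<in> K"
      using that S(1) False by (simp add: K_def subspace_scale)
    from min[OF this] have "c \<le> (u \<bullet> (M *v u)) / (norm u)\<^sup>2"
      by (simp add: c_def matrix_vector_mult_scaleR power2_eq_square)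
    then show ?thesis
      using False by (simp add: field_simps power2_norm_eq_inner)
  qed simp
  \<comment> \<open>The residual \<open>w\<close> lies in \<open>S\<close> by invariance, so
    \<open>v + t *\<^sub>R w\<close> is an admissible variation. Its linear coefficient is
    \<open>2 * (w \<bullet> w)\<close>, which forces \<open>w = 0\<close>.\<close>
  define w where "w = M *v v - c *\<^sub>R v"
  have wS: "w \<in> S"
    by (simp add: w_def S(1) subspace_diff subspace_scale inv vS)
  have "0 \<le> t * (2 * (w \<bullet> w)) + t\<^sup>2 * (w \<bullet> (M *v w) - c * (w \<bullet> w))" for t
  proof -
    have "c * ((v + t *\<^sub>R w) \<bullet> (v + t *\<^sub>R w)) \<le> (v + t *\<^sub>R w) \<bullet> (M *v (v + t *\<^sub>R w))"
      by (rule ray) (simp add: S(1) subspace_add subspace_scale vS wS)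
    moreover have "(v + t *\<^sub>R w) \<bullet> (M *v (v + t *\<^sub>R w)) =
        c + 2 * t * (w \<bullet> (M *v v)) + t\<^sup>2 * (w \<bullet> (M *v w))"
      using symmetric_matrix_inner[OF M, of v w]
      by (simp add: c_def matrix_vector_right_distrib matrix_vector_mult_scaleR inner_add_left
          inner_add_right inner_commute power2_eq_square algebra_simps)
    moreover have "(v + t *\<^sub>R w) \<bullet> (v + t *\<^sub>R w) = 1 + 2 * t * (w \<bullet> v) + t\<^sup>2 * (w \<bullet> w)"
      using v1 by (simp add: norm_eq_1 inner_add_left inner_add_right inner_commute power2_eq_square algebra_simps)
    ultimately have "c * (1 + 2 * t * (w \<bullet> v) + t\<^sup>2 * (w \<bullet> w)) \<le>
        c + 2 * t * (w \<bullet> (M *v v)) + t\<^sup>2 * (w \<bullet> (M *v w))"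
      by metis
    moreover have "w \<bullet> w = w \<bullet> (M *v v) - c * (w \<bullet> v)"
      by (metis inner_diff_right inner_scaleR_right w_def)
    then have "t * (2 * (w \<bullet> w)) + t\<^sup>2 * (w \<bullet> (M *v w) - c * (w \<bullet> w)) =
        c + 2 * t * (w \<bullet> (M *v v)) + t\<^sup>2 * (w \<bullet> (M *v w)) -
        c * (1 + 2 * t * (w \<bullet> v) + t\<^sup>2 * (w \<bullet> w))"
      by algebra
    ultimately show ?thesis
      by linarith
  qed
  then have "2 * (w \<bullet> w) = 0"
    by (rule quadratic_nonneg_imp_linear_zero)
  then have "M *v v = c *\<^sub>R v"
    by (simp add: w_def)
  moreover have "v \<noteq> 0" using v1 by auto
  ultimately show thesis
    using that vS ray by blast
qed

section \<open>Eigenspaces and the ordered list of eigenvalues\<close>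

abbreviation eigenspace :: "real^'m^'m \<Rightarrow> real \<Rightarrow> (real^'m) set"
  where "eigenspace M c \<equiv> {v. M *v v = c *\<^sub>R v}"

lemma eigenvectors_orthogonal:
  assumes M: "symmetric_matrix M" and "M *v u = a *\<^sub>R u" "M *v w = b *\<^sub>R w" "a \<noteq> b"
  shows "u \<bullet> w = 0"
  using symmetric_matrix_inner[OF M, of u w] assms by simp

text \<open>One eigenvector per eigenvalue gives an orthogonal, hence independent, family.
  Finiteness makes the sum in \<open>eigenvalue_list\<close> meaningful, as a sum over an infinite
  set is 0 by default.\<close>

lemma finite_spectrum:
  fixes M :: "real^'m^'m"
  assumes M: "symmetric_matrix M"
  shows "finite (spectrum M)"
proof -
  have "\<forall>c\<in>spectrum M. \<exists>v. v \<noteq> 0 \<and> M *v v = c *\<^sub>R v"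
    by (auto simp: spectrum_def)
  then obtain g where g: "\<And>c. c \<in> spectrum M \<Longrightarrow> g c \<noteq> 0 \<and> M *v g c = c *\<^sub>R g c"
    using bchoice[of "spectrum M" "\<lambda>c v. v \<noteq> 0 \<and> M *v v = c *\<^sub>R v"] by auto
  have inj: "inj_on g (spectrum M)"
  proof (rule inj_onI)
    fix a b assume "a \<in> spectrum M" "b \<in> spectrum M" "g a = g b"
    then have "a *\<^sub>R g a = b *\<^sub>R g a" "g a \<noteq> 0"
      using g by metis+
    then show "a = b" by simp
  qed
  have "independent (g ` spectrum M)"
  proof (rule pairwise_orthogonal_independent)
    show "pairwise orthogonal (g ` spectrum M)"
    proof (rule pairwiseI)
      fix x y assume "x \<in> g ` spectrum M" "y \<in> g ` spectrum M" "x \<noteq> y"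
      then obtain a b where "a \<in> spectrum M" "b \<in> spectrum M" "a \<noteq> b" "x = g a" "y = g b"
        by blast
      with g[of a] g[of b] show "orthogonal x y"
        using eigenvectors_orthogonal[OF M, of x a y b] by (simp add: orthogonal_def)
    qed
    show "0 \<notin> g ` spectrum M"
      using g by (metis imageE)
  qed
  then have "finite (g ` spectrum M)"
    by (rule independent_imp_finite)
  then show ?thesis
    using finite_imageD inj by blast
qed

text \<open>The orthogonal complement of all eigenvectors is invariant; were it nonzero, it would
  contain an eigenvector, which would be orthogonal to itself.\<close>

lemma span_eigenvectors:
  fixes M :: "real^'m^'m"
  assumes M: "symmetric_matrix M"
  shows "span (\<Union>c\<in>spectrum M. eigenspace M c) = UNIV"
proof (rule ccontr)
  let ?W = "\<Union>c\<in>spectrum M. eigenspace M c"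
  define S where "S = {u. \<forall>w\<in>?W. u \<bullet> w = 0}"
  assume "span ?W \<noteq> UNIV"
  then obtain z where "z \<noteq> 0" and "\<And>w. w \<in> span ?W \<Longrightarrow> orthogonal z w"
    using orthogonal_to_subspace_exists_gen[of ?W UNIV] by auto
  then have "z \<in> S"
    unfolding S_def orthogonal_def by (blast intro: span_base)
  with \<open>z \<noteq> 0\<close> have "S \<noteq> {0}" by blast
  moreover have "subspace S"
    by (auto simp: S_def subspace_def inner_add_left)
  moreover have "M *v u \<in> S" if "u \<in> S" for u
  proof -
    have "(M *v u) \<bullet> w = 0" if "w \<in> eigenspace M c" "c \<in> spectrum M" for w c
    proof -
      have "u \<bullet> w = 0"
        using \<open>u \<in> S\<close> that by (auto simp: S_def)
      with that(1) show ?thesis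
        by (simp add: symmetric_matrix_inner[OF M])
    qed
    then show ?thesis by (auto simp: S_def)
  qed
  ultimately obtain v c where v: "v \<in> S" "v \<noteq> 0" "M *v v = c *\<^sub>R v"
    using eigenvector_minimizing_Rayleigh[OF M, of S thesis] by simp
  then have "v \<in> ?W"
    by (auto simp: spectrum_def)
  with v(1) have "v \<bullet> v = 0"
    unfolding S_def by blast
  with v(2) show False by simp
qed

text \<open>The union of bases of the eigenspaces spans the whole space. The bound keeps the indices
  used in \<open>smallest_eigenvectors\<close> inside the list.\<close>

lemma length_eigenvalue_list:
  fixes M :: "real^'m^'m"
  assumes M: "symmetric_matrix M"
  shows "CARD('m) \<le> length (eigenvalue_list M)"
proof -
  have "\<forall>c. \<exists>B. finite B \<and> eigenspace M c \<subseteq> span B \<and> card B = dim (eigenspace M c)"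
  proof
    fix c
    obtain B where "independent B" "eigenspace M c \<subseteq> span B" "card B = dim (eigenspace M c)"
      by (rule basis_exists[of "eigenspace M c"])
    then show "\<exists>B. finite B \<and> eigenspace M c \<subseteq> span B \<and> card B = dim (eigenspace M c)"
      using independent_imp_finite by blast
  qed
  from choice[OF this] obtain B where B: "\<And>c. finite (B c)" "\<And>c. eigenspace M c \<subseteq> span (B c)"
      "\<And>c. card (B c) = dim (eigenspace M c)"
    by blast
  have "span (B c) \<subseteq> span (\<Union>c\<in>spectrum M. B c)" if "c \<in> spectrum M" for c
    using that by (intro span_mono) auto
  with B(2) have "(\<Union>c\<in>spectrum M. eigenspace M c) \<subseteq> span (\<Union>c\<in>spectrum M. B c)"
    by (intro UN_least) (rule subset_trans)
  from span_mono[OF this] have "span (\<Union>c\<in>spectrum M. B c) = UNIV"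
    unfolding span_eigenvectors[OF M] span_span by (rule top.extremum_uniqueI)
  then have "CARD('m) \<le> card (\<Union>c\<in>spectrum M. B c)"
    using dim_le_card[of UNIV "\<Union>c\<in>spectrum M. B c"] finite_spectrum[OF M] B(1) by simp
  also have "\<dots> \<le> (\<Sum>c\<in>spectrum M. card (B c))"
    by (rule card_UN_le[OF finite_spectrum[OF M]])
  also have "\<dots> = length (eigenvalue_list M)"
    by (simp add: eigenvalue_list_def B(3) size_mset[symmetric] size_multiset_sum del: size_mset)
  finally show ?thesis .
qed

lemma count_eigenvalue_list:
  assumes M: "symmetric_matrix M" and "c \<in> spectrum M"
  shows "card {j. j < length (eigenvalue_list M) \<and> eigenvalue_list M ! j = c} = dim (eigenspace M c)"
proof -
  have "card {j. j < length (eigenvalue_list M) \<and> eigenvalue_list M ! j = c} =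
      count (mset (eigenvalue_list M)) c"
    by (simp add: count_mset count_list_eq_length_filter length_filter_conv_card eq_commute)
  also have "\<dots> = (\<Sum>b\<in>spectrum M. if c = b then dim (eigenspace M b) else 0)"
    by (simp add: eigenvalue_list_def count_sum)
  also have "\<dots> = dim (eigenspace M c)"
    using assms finite_spectrum[OF M] by simp
  finally show ?thesis .
qed

section \<open>Orthonormal eigenvectors for the smallest eigenvalues\<close>

lemma orthonormal_columns_inj:
  "orthonormal_columns p E \<Longrightarrow> inj_on E {..<p}"
  unfolding orthonormal_columns_def inj_on_def
  by (metis lessThan_iff zero_neq_one)

text \<open>
  If \<open>\<mu>\<close> were smaller than some listed eigenvalue, then all copies of \<open>\<mu>\<close> would be listed, so the
  columns would contain a basis of its eigenspace.
\<close>

lemma smallest_eigenvectors_le: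
  fixes M :: "real^'m^'m"
  assumes M: "symmetric_matrix M" and p: "p \<le> CARD('m)"
    and on: "orthonormal_columns p E" and sm: "smallest_eigenvectors M p E"
    and u: "M *v u = \<mu> *\<^sub>R u" "u \<noteq> 0" "\<And>i. i < p \<Longrightarrow> E i \<bullet> u = 0"
    and i0: "i0 < p"
  shows "E i0 \<bullet> (M *v E i0) \<le> \<mu>"
proof (rule ccontr)
  assume less: "\<not> ?thesis"
  define L where "L = eigenvalue_list M"
  obtain \<pi> where \<pi>: "\<pi> permutes {..<p}" and eig: "\<And>i. i < p \<Longrightarrow> M *v E i = (L ! \<pi> i) *\<^sub>R E i"
    using sm by (auto simp: smallest_eigenvectors_def L_def)
  have len: "p \<le> length L"
    using length_eigenvalue_list[OF M] p by (simp add: L_def)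
  have sorted: "sorted L"
    by (simp add: L_def eigenvalue_list_def)
  have \<pi>less: "\<pi> i < p" if "i < p" for i
    using permutes_in_image[OF \<pi>, of i] that by simp
  have gt: "\<mu> < L ! \<pi> i0"
    using less i0 on eig[OF i0] by (simp add: orthonormal_columns_def)
  have \<mu>: "\<mu> \<in> spectrum M"
    using u by (auto simp: spectrum_def)
  define I where "I = {i. i < p \<and> L ! \<pi> i = \<mu>}"
  have "{j. j < length L \<and> L ! j = \<mu>} = \<pi> ` I"
  proof (intro set_eqI iffI)
    fix j assume "j \<in> {j. j < length L \<and> L ! j = \<mu>}"
    then have j: "j < length L" "L ! j = \<mu>" by auto
    \<comment> \<open>Since the list is sorted, a position holding \<mu> comes before
      \<open>\<pi> i0\<close>, where the entry is larger.\<close>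
    have "j < p"
      using sorted_nth_mono[OF sorted, of "\<pi> i0" j] j gt \<pi>less[OF i0] by linarith
    then obtain i where "i < p" "j = \<pi> i"
      by (metis \<pi> imageE lessThan_iff permutes_image)
    with j show "j \<in> \<pi> ` I" by (auto simp: I_def)
  qed (use \<pi>less len in \<open>auto simp: I_def intro: less_le_trans\<close>)
  then have "card I = dim (eigenspace M \<mu>)"
    using count_eigenvalue_list[OF M \<mu>] card_image[of \<pi> I] permutes_inj_on[OF \<pi>]
    by (simp add: L_def)
  \<comment> \<open>Being orthogonal to the columns, \<open>u\<close> is one independent eigenvector
    more than the eigenspace can hold.\<close>
  moreover have "card (insert u (E ` I)) = Suc (card I)"
  proof -
    have "finite I" "I \<subseteq> {..<p}" by (auto simp: I_def)
    moreover have "u \<notin> E ` I"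
      using u(2,3) by (metis (no_types, lifting) I_def imageE inner_eq_zero_iff mem_Collect_eq)
    ultimately show ?thesis
      using orthonormal_columns_inj[OF on] by (simp add: card_image inj_on_subset)
  qed
  moreover have "card (insert u (E ` I)) \<le> dim (eigenspace M \<mu>)"
  proof (rule independent_card_le_dim)
    show "insert u (E ` I) \<subseteq> eigenspace M \<mu>"
      using u eig by (auto simp: I_def)
    show "independent (insert u (E ` I))"
    proof (rule pairwise_orthogonal_independent)
      show "pairwise orthogonal (insert u (E ` I))"
        using on u(3) by (auto simp: pairwise_def orthogonal_def orthonormal_columns_def I_def inner_commute)
      show "0 \<notin> insert u (E ` I)"
        using u(2) on by (auto simp: I_def orthonormal_columns_def) (metis inner_zero_left zero_neq_one)
    qed
  qed
  ultimately show False by simp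
qed

text \<open>On the complement of the columns, the least Rayleigh quotient is the eigenvalue of an
  eigenvector orthogonal to them, to which the previous comparison applies. Unlike a statement about
  list entries, this inequality survives limits.\<close>

lemma smallest_eigenvectors_Rayleigh:
  fixes M :: "real^'m^'m"
  assumes M: "symmetric_matrix M" and p: "p \<le> CARD('m)"
    and on: "orthonormal_columns p E" and sm: "smallest_eigenvectors M p E"
    and u: "\<And>i. i < p \<Longrightarrow> E i \<bullet> u = 0" and i: "i < p"
  shows "(E i \<bullet> (M *v E i)) * (u \<bullet> u) \<le> u \<bullet> (M *v u)"
proof (cases "u = 0")
  case False
  define S where "S = {u. \<forall>i<p. E i \<bullet> u = 0}"
  have "subspace S"
    by (auto simp: S_def subspace_def inner_add_right)
  moreover have "S \<noteq> {0}"
    using u False by (auto simp: S_def)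
  moreover have "M *v v \<in> S" if "v \<in> S" for v
    using that sm by (auto simp: S_def smallest_eigenvectors_def symmetric_matrix_inner[OF M, symmetric])
  ultimately obtain v c where v: "v \<in> S" "v \<noteq> 0" "M *v v = c *\<^sub>R v"
      and c: "\<And>u. u \<in> S \<Longrightarrow> c * (u \<bullet> u) \<le> u \<bullet> (M *v u)"
    using eigenvector_minimizing_Rayleigh[OF M] by metis
  have "E i \<bullet> (M *v E i) \<le> c"
    using v by (intro smallest_eigenvectors_le[OF M p on sm, of v] i) (auto simp: S_def)
  then have "(E i \<bullet> (M *v E i)) * (u \<bullet> u) \<le> c * (u \<bullet> u)"
    by (intro mult_right_mono) auto
  also have "\<dots> \<le> u \<bullet> (M *v u)"
    using u by (intro c) (auto simp: S_def)
  finally show ?thesis .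
qed simp

text \<open>The kernel of a symmetric matrix is the orthogonal complement of its range.\<close>

lemma dim_kernel_symmetric:
  fixes M :: "real^'m^'m"
  assumes M: "symmetric_matrix M"
  shows "dim {v. M *v v = 0} = CARD('m) - rank M"
proof -
  have "{v. M *v v = 0} = {y \<in> UNIV. \<forall>x \<in> range ((*v) M). orthogonal x y}"
    by (auto simp: orthogonal_def symmetric_matrix_inner[OF M])
      (metis inner_eq_zero_iff symmetric_matrix_inner[OF M])
  moreover have "subspace (range ((*v) M))"
    by (simp add: linear_subspace_image)
  ultimately show ?thesis
    using dim_subspace_orthogonal_to_vectors[of "range ((*v) M)" UNIV]
    by (simp add: rank_dim_range)
qed

lemma orthonormal_columns_residual:
  assumes "orthonormal_columns p E" "j < p"
  shows "E j \<bullet> (z - (\<Sum>i<p. (E i \<bullet> z) *\<^sub>R E i)) = 0"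
proof -
  have "(\<Sum>i<p. (E i \<bullet> z) * (E j \<bullet> E i)) = (\<Sum>i<p. if i = j then E i \<bullet> z else 0)"
    using assms by (intro sum.cong) (auto simp: orthonormal_columns_def)
  then show ?thesis
    using assms by (simp add: inner_diff_right inner_sum_right)
qed

text \<open>
  In the limit the Rayleigh bound says that \<open>M\<close> is at least \<open>Ebar q \<bullet> (M *v Ebar q)\<close> on the orthogonal
  complement of the limiting columns. Were this positive for some \<open>q\<close>, the kernel of \<open>M\<close> would be
  spanned by the other \<open>p - 1\<close> columns.
\<close>

lemma limit_smallest_eigenvectors_kernel:
  fixes M :: "real^'m^'m" and A :: "nat \<Rightarrow> real^'m^'m"
  assumes A: "\<And>k. symmetric_matrix (A k)" "A \<longlonglongrightarrow> M" and M: "psd M"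
    and p: "p = CARD('m) - rank M"
    and E: "\<And>k. orthonormal_columns p (E k)" "\<And>k. smallest_eigenvectors (A k) p (E k)"
      "\<And>i. i < p \<Longrightarrow> (\<lambda>k. E k i) \<longlonglongrightarrow> Ebar i"
    and z: "M *v z = 0"
  shows "z = (\<Sum>i<p. (Ebar i \<bullet> z) *\<^sub>R Ebar i)"
proof -
  have sym: "symmetric_matrix M" using M by (simp add: psd_def)
  define c where "c i = Ebar i \<bullet> (M *v Ebar i)" for i
  have on: "orthonormal_columns p Ebar"
    unfolding orthonormal_columns_def
  proof (intro allI impI)
    fix i j assume ij: "i < p" "j < p"
    have "(\<lambda>k. E k i \<bullet> E k j) \<longlonglongrightarrow> Ebar i \<bullet> Ebar j"
      by (intro tendsto_intros E ij)
    moreover have "(\<lambda>k. E k i \<bullet> E k j) = (\<lambda>k. if i = j then 1 else 0)"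
      using E(1) ij by (auto simp: orthonormal_columns_def)
    ultimately show "Ebar i \<bullet> Ebar j = (if i = j then 1 else 0)"
      using LIMSEQ_const_iff[of "if i = j then 1 else 0 :: real" "Ebar i \<bullet> Ebar j"] by simp
  qed
  have ray: "(\<lambda>k. E k i \<bullet> (A k *v E k i)) \<longlonglongrightarrow> c i" if "i < p" for i
    unfolding c_def by (intro tendsto_intros tendsto_matrix_vector_mult A E that)
  have eig: "M *v Ebar i = c i *\<^sub>R Ebar i" if i: "i < p" for i
  proof -
    \<comment> \<open>Replacing the list entry by a Rayleigh quotient gives convergence of the
      eigenvalue from that of the matrix and the column.\<close>
    have "A k *v E k i = (E k i \<bullet> (A k *v E k i)) *\<^sub>R E k i" for k
    proof -
      obtain b where b: "A k *v E k i = b *\<^sub>R E k i"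
        using E(2)[of k] i by (auto simp: smallest_eigenvectors_def)
      then show ?thesis
        using E(1)[of k] i by (simp add: orthonormal_columns_def)
    qed
    then have "(\<lambda>k. A k *v E k i) \<longlonglongrightarrow> c i *\<^sub>R Ebar i"
      using tendsto_scaleR[OF ray[OF i] E(3)[OF i]] by presburger
    moreover have "(\<lambda>k. A k *v E k i) \<longlonglongrightarrow> M *v Ebar i"
      by (intro tendsto_matrix_vector_mult A E i)
    ultimately show ?thesis
      by (rule LIMSEQ_unique[symmetric])
  qed
  have bound: "c i * (u \<bullet> u) \<le> u \<bullet> (M *v u)"
    if i: "i < p" and u: "\<And>j. j < p \<Longrightarrow> Ebar j \<bullet> u = 0" for i u
  proof (rule LIMSEQ_le)
    \<comment> \<open>The vector \<open>u\<close> is orthogonal to the limiting columns but perhaps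
      not to those of \<open>E k\<close>; \<open>w k\<close> removes the components along the latter
      and still tends to \<open>u\<close>.\<close>
    define w where "w k = u - (\<Sum>j<p. (E k j \<bullet> u) *\<^sub>R E k j)" for k
    have "w \<longlonglongrightarrow> u - (\<Sum>j<p. (Ebar j \<bullet> u) *\<^sub>R Ebar j)"
      unfolding w_def by (intro tendsto_intros E) auto
    then have w: "w \<longlonglongrightarrow> u"
      using u by simp
    show "(\<lambda>k. (E k i \<bullet> (A k *v E k i)) * (w k \<bullet> w k)) \<longlonglongrightarrow> c i * (u \<bullet> u)"
      by (intro tendsto_intros ray i w)
    show "(\<lambda>k. w k \<bullet> (A k *v w k)) \<longlonglongrightarrow> u \<bullet> (M *v u)"
      by (intro tendsto_intros tendsto_matrix_vector_mult w A)
    have "p \<le> CARD('m)"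
      by (simp add: p)
    moreover have "E k j \<bullet> w k = 0" if "j < p" for k j
      unfolding w_def by (rule orthonormal_columns_residual[OF E(1) that])
    ultimately have "(E k i \<bullet> (A k *v E k i)) * (w k \<bullet> w k) \<le> w k \<bullet> (A k *v w k)" for k
      by (intro smallest_eigenvectors_Rayleigh[OF A(1) _ E(1) E(2) _ i])
    then show "\<exists>N. \<forall>k\<ge>N. (E k i \<bullet> (A k *v E k i)) * (w k \<bullet> w k) \<le> w k \<bullet> (A k *v w k)"
      by blast
  qed
  have pos: "0 \<le> c i" for i
    using M by (simp add: c_def psd_def)
  have eq0: "c i = 0" if i: "i < p" for i
  proof (rule ccontr)
    assume "c i \<noteq> 0"
    with pos have ci: "0 < c i" by (simp add: order_less_le)
    have "{v. M *v v = 0} \<subseteq> span (Ebar ` ({..<p} - {i}))"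
    proof
      fix v assume "v \<in> {v. M *v v = 0}"
      then have v: "M *v v = 0" by simp
      define u where "u = v - (\<Sum>j<p. (Ebar j \<bullet> v) *\<^sub>R Ebar j)"
      have orth: "Ebar j \<bullet> u = 0" if "j < p" for j
        unfolding u_def by (rule orthonormal_columns_residual[OF on that])
      have coeff: "c j * (Ebar j \<bullet> v) = 0" if "j < p" for j
        using symmetric_matrix_inner[OF sym, of "Ebar j" v] by (simp add: eig[OF that] v)
      have "M *v u = - (\<Sum>j<p. (c j * (Ebar j \<bullet> v)) *\<^sub>R Ebar j)"
        by (simp add: u_def matrix_vector_mult_diff_distrib v linear_sum[OF matrix_vector_mul_linear]
            matrix_vector_mult_scaleR eig mult.commute cong: sum.cong_simp)
      also have "\<dots> = 0"
        using coeff by (simp add: sum.neutral)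
      finally have "c i * (u \<bullet> u) \<le> 0"
        using bound[OF i orth] by simp
      then have "u = 0"
        using ci by (metis inner_eq_zero_iff inner_ge_zero mult_pos_pos not_less order_less_le)
      then have "v = (\<Sum>j<p. (Ebar j \<bullet> v) *\<^sub>R Ebar j)"
        by (simp add: u_def)
      also have "\<dots> = (\<Sum>j\<in>{..<p} - {i}. (Ebar j \<bullet> v) *\<^sub>R Ebar j)"
        using coeff[OF i] ci by (intro sum.mono_neutral_right) auto
      also have "\<dots> \<in> span (Ebar ` ({..<p} - {i}))"
        by (intro span_sum span_scale span_base) auto
      finally show "v \<in> span (Ebar ` ({..<p} - {i}))" .
    qed
    then have "dim {v. M *v v = 0} \<le> card (Ebar ` ({..<p} - {i}))"
      by (intro dim_le_card) auto
    also have "\<dots> \<le> card ({..<p} - {i})"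
      by (rule card_image_le) simp
    also have "\<dots> < p"
      using i by simp
    finally show False
      using dim_kernel_symmetric[OF sym] p by simp
  qed
  \<comment> \<open>The \<open>p\<close> limiting columns are independent kernel vectors, and
    \<open>p\<close> is the dimension of the kernel, so they span it.\<close>
  have "independent (Ebar ` {..<p})"
  proof (rule pairwise_orthogonal_independent)
    show "pairwise orthogonal (Ebar ` {..<p})"
      using on by (auto simp: pairwise_def orthogonal_def orthonormal_columns_def)
    show "0 \<notin> Ebar ` {..<p}"
      using on by (auto simp: orthonormal_columns_def) (metis inner_zero_left zero_neq_one)
  qed
  moreover have "Ebar ` {..<p} \<subseteq> {v. M *v v = 0}"
    using eig eq0 by auto
  moreover have "dim {v. M *v v = 0} \<le> card (Ebar ` {..<p})"
    unfolding card_image[OF orthonormal_columns_inj[OF on]] by (simp add: dim_kernel_symmetric[OF sym] p)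
  ultimately have "{v. M *v v = 0} \<subseteq> span (Ebar ` {..<p})"
    by (intro card_ge_dim_independent)
  with z have zs: "z \<in> span (Ebar ` {..<p})" by auto
  define u where "u = z - (\<Sum>i<p. (Ebar i \<bullet> z) *\<^sub>R Ebar i)"
  have us: "u \<in> span (Ebar ` {..<p})"
    unfolding u_def by (intro span_diff zs span_sum span_scale span_base) auto
  have "orthogonal u u"
  proof (rule orthogonal_to_span[OF us])
    fix y assume "y \<in> Ebar ` {..<p}"
    then show "orthogonal u y"
      using orthonormal_columns_residual[OF on] by (auto simp: u_def orthogonal_def inner_commute)
  qed
  then show ?thesis
    by (simp add: u_def orthogonal_def)
qed

section \<open>Derivatives\<close>

lemma has_derivative_imp_partial_derivative:
  fixes g :: "real^'n \<Rightarrow> 'b::real_normed_vector"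
  assumes "(g has_derivative g') (at x)"
  shows "partial_derivative l g x = g' (axis l 1)"
proof -
  have "((\<lambda>t. x + t *\<^sub>R axis l 1) has_derivative (\<lambda>t. t *\<^sub>R axis l 1)) (at 0)"
    by (auto intro!: derivative_eq_intros)
  then have "((\<lambda>t. g (x + t *\<^sub>R axis l 1)) has_derivative (\<lambda>t. g' (t *\<^sub>R axis l 1))) (at 0)"
    by (rule has_derivative_compose) (simp add: assms)
  then have "((\<lambda>t. g (x + t *\<^sub>R axis l 1)) has_vector_derivative g' (axis l 1)) (at 0)"
    using linear_scale[OF has_derivative_linear[OF assms]] by (simp add: has_vector_derivative_def)
  then show ?thesis
    unfolding partial_derivative_def by (rule vector_derivative_at)
qed

lemma continuously_differentiable_tendsto_partial_derivative:
  fixes g :: "real^'n \<Rightarrow> 'b::real_normed_vector"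
  assumes "continuously_differentiable g" and "x \<longlonglongrightarrow> y"
  shows "(\<lambda>k. partial_derivative l g (x k)) \<longlonglongrightarrow> partial_derivative l g y"
proof -
  obtain g' where g': "\<And>x. (g has_derivative blinfun_apply (g' x)) (at x)" "continuous_on UNIV g'"
    using assms(1) by (auto simp: continuously_differentiable_def)
  have "(\<lambda>k. g' (x k)) \<longlonglongrightarrow> g' y"
    using g'(2) assms(2) by (simp add: continuous_on_eq_continuous_at isCont_tendsto_compose)
  then have "(\<lambda>k. blinfun_apply (g' (x k)) (axis l 1)) \<longlonglongrightarrow> blinfun_apply (g' y) (axis l 1)"
    by (intro tendsto_intros)
  then show ?thesis
    by (simp add: has_derivative_imp_partial_derivative[OF g'(1)])
qed

lemma continuously_differentiable_continuous:
  "continuously_differentiable g \<Longrightarrow> continuous_on S g"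
  unfolding continuously_differentiable_def
  by (meson has_derivative_continuous continuous_at_imp_continuous_on)

lemma adjoint_derivative_scaleR: "adjoint_derivative G x (c *\<^sub>R Y) = c *\<^sub>R adjoint_derivative G x Y"
  by (simp add: adjoint_derivative_def trace_inner_def trace_def matrix_matrix_mult_def vec_eq_iff
      sum_distrib_left mult_ac)

lemma tendsto_adjoint_derivative:
  fixes G :: "real^'n \<Rightarrow> real^'m^'m"
  assumes "continuously_differentiable G" "x \<longlonglongrightarrow> y" "Z \<longlonglongrightarrow> W"
  shows "(\<lambda>k. adjoint_derivative G (x k) (Z k)) \<longlonglongrightarrow> adjoint_derivative G y W"
proof (rule vec_tendstoI)
  fix l
  have "(\<lambda>k. partial_derivative l G (x k) ** Z k) \<longlonglongrightarrow> partial_derivative l G y ** W"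
    by (intro tendsto_matrix_matrix_mult assms continuously_differentiable_tendsto_partial_derivative)
  then show "(\<lambda>k. adjoint_derivative G (x k) (Z k) $ l) \<longlonglongrightarrow> adjoint_derivative G y W $ l"
    unfolding adjoint_derivative_def trace_inner_def trace_def by (simp, intro tendsto_intros)
qed

lemma tendsto_gradient:
  assumes "continuously_differentiable f" "x \<longlonglongrightarrow> y"
  shows "(\<lambda>k. gradient f (x k)) \<longlonglongrightarrow> gradient f y"
  unfolding gradient_def
  by (rule vec_tendstoI) (simp add: continuously_differentiable_tendsto_partial_derivative[OF assms])

section \<open>Quadratic penalization\<close>

text \<open>The point \<open>P\<close> is held fixed, so only a smooth function is differentiated,
  never the distance to the cone. The proximal term contributes \<open>x - a\<close> and the penalty
  term contributes the multiplier.\<close>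

lemma penalty_stationary:
  fixes f :: "real^'n \<Rightarrow> real" and G :: "real^'n \<Rightarrow> real^'m^'m"
  assumes f: "continuously_differentiable f" and G: "continuously_differentiable G"
    and sym: "symmetric_matrix (P - G x)"
    and min: "eventually (\<lambda>y. f x + (dist x a)\<^sup>2 / 2 + c / 2 * (dist (G x) P)\<^sup>2 \<le>
      f y + (dist y a)\<^sup>2 / 2 + c / 2 * (dist (G y) P)\<^sup>2) (at x)"
  shows "gradient f x + (x - a) = adjoint_derivative G x (c *\<^sub>R (P - G x))"
proof -
  obtain f' G' where f': "(f has_derivative f') (at x)" and G': "(G has_derivative G') (at x)"
    using f G by (auto simp: continuously_differentiable_def)
  have eq: "f y + (dist y a)\<^sup>2 / 2 + c / 2 * (dist (G y) P)\<^sup>2 =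
      f y + ((y - a) \<bullet> (y - a)) / 2 + c / 2 * ((G y - P) \<bullet> (G y - P))" for y
    by (simp add: dist_norm power2_norm_eq_inner)
  have "((\<lambda>y. f y + ((y - a) \<bullet> (y - a)) / 2 + c / 2 * ((G y - P) \<bullet> (G y - P))) has_derivative
      (\<lambda>h. f' h + (x - a) \<bullet> h + c * ((G x - P) \<bullet> G' h))) (at x)"
    by (auto intro!: derivative_eq_intros f' G' simp: inner_commute algebra_simps diff_divide_distrib)
  from has_derivative_local_min[OF this min[unfolded eq]]
  have *: "f' h + (x - a) \<bullet> h + c * ((G x - P) \<bullet> G' h) = 0" for h
    by metis
  show ?thesis
  proof (rule vec_eq_iff[THEN iffD2], rule allI)
    fix l
    have "trace_inner (G' (axis l 1)) (c *\<^sub>R (P - G x)) = c * ((P - G x) \<bullet> G' (axis l 1))"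
      using sym by (simp add: trace_inner_symmetric symmetric_matrix_scaleR inner_commute)
    also have "\<dots> = f' (axis l 1) + (x - a) \<bullet> axis l 1"
      using *[of "axis l 1"] by (simp add: inner_diff_left algebra_simps)
    finally show "(gradient f x + (x - a)) $ l = adjoint_derivative G x (c *\<^sub>R (P - G x)) $ l"
      by (simp add: gradient_def adjoint_derivative_def inner_axis
          has_derivative_imp_partial_derivative[OF f'] has_derivative_imp_partial_derivative[OF G'])
  qed
qed

text \<open>Minimize over a compact ball with growing penalty weights. Comparison with
  \<open>xbar\<close> forces a cluster point to be feasible; local minimality and the proximal term
  then force it to be \<open>xbar\<close>.\<close>

lemma penalty_minimizers:
  fixes f :: "real^'n \<Rightarrow> real" and G :: "real^'n \<Rightarrow> real^'m^'m"
  assumes f: "continuous_on UNIV f" and G: "continuous_on UNIV G" and min: "local_minimizer f G xbar"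
  obtains x \<rho> \<delta> where "0 < \<delta>" "\<And>k. 0 \<le> \<rho> k" "x \<longlonglongrightarrow> xbar"
    "\<And>k y. y \<in> cball xbar \<delta> \<Longrightarrow>
      f (x k) + (dist (x k) xbar)\<^sup>2 / 2 + \<rho> k / 2 * (infdist (G (x k)) {M. psd M})\<^sup>2 \<le>
      f y + (dist y xbar)\<^sup>2 / 2 + \<rho> k / 2 * (infdist (G y) {M. psd M})\<^sup>2"
proof -
  define d where "d y = infdist (G y) {M. psd M}" for y
  have ne: "{M::real^'m^'m. psd M} \<noteq> {}" using psd_0 by blast
  have cont_d: "continuous_on S d" for S
    unfolding d_def by (intro continuous_intros continuous_on_subset[OF G]) auto
  have cont_f: "continuous_on S f" for S
    by (rule continuous_on_subset[OF f]) auto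
  have d0: "d y = 0 \<longleftrightarrow> psd (G y)" for y
    unfolding d_def using in_closed_iff_infdist_zero[OF closed_psd ne, of "G y"] by simp
  obtain \<epsilon> where \<epsilon>: "0 < \<epsilon>" and loc: "\<And>y. psd (G y) \<Longrightarrow> y \<in> ball xbar \<epsilon> \<Longrightarrow> f xbar \<le> f y"
    and feas: "psd (G xbar)"
    using min unfolding local_minimizer_def feasible_set_def by blast
  \<comment> \<open>Halving puts the closed ball, and hence every cluster point, inside the open
    ball of local minimality.\<close>
  define \<delta> where "\<delta> = \<epsilon> / 2"
  define F where "F k y = f y + (dist y xbar)\<^sup>2 / 2 + real k / 2 * (d y)\<^sup>2" for k :: nat and y
  have \<delta>: "0 < \<delta>" using \<epsilon> by (simp add: \<delta>_def)
  have "\<exists>x\<in>cball xbar \<delta>. \<forall>y\<in>cball xbar \<delta>. F k x \<le> F k y" for k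
    unfolding F_def
    by (intro continuous_attains_inf continuous_intros cont_d cont_f) (use \<delta> in auto)
  then have "\<forall>k. \<exists>x. x \<in> cball xbar \<delta> \<and> (\<forall>y\<in>cball xbar \<delta>. F k x \<le> F k y)"
    by blast
  from choice[OF this] obtain x where x: "\<And>k. x k \<in> cball xbar \<delta>"
    and xmin: "\<And>k y. y \<in> cball xbar \<delta> \<Longrightarrow> F k (x k) \<le> F k y"
    by blast
  have "seq_compact (cball xbar \<delta>)"
    by (intro compact_imp_seq_compact compact_cball)
  then obtain l r where l: "l \<in> cball xbar \<delta>" and r: "strict_mono r" and lim: "(x \<circ> r) \<longlonglongrightarrow> l"
    by (rule seq_compactE) (use x in auto)
  have lim_f: "(\<lambda>k. f (x (r k))) \<longlonglongrightarrow> f l"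
    using continuous_on_tendsto_compose[OF f lim] by (simp add: o_def)
  have lim_d: "(\<lambda>k. d (x (r k))) \<longlonglongrightarrow> d l"
    using continuous_on_tendsto_compose[OF cont_d[of UNIV] lim] by (simp add: o_def)
  have lim_dist: "(\<lambda>k. dist (x (r k)) xbar) \<longlonglongrightarrow> dist l xbar"
    using lim by (intro tendsto_intros) (simp add: o_def)
  \<comment> \<open>The value at \<open>xbar\<close> is just \<open>f xbar\<close>, since its
    penalty and proximal terms vanish.\<close>
  have bound: "f (x (r k)) + (dist (x (r k)) xbar)\<^sup>2 / 2 + real (r k) / 2 * (d (x (r k)))\<^sup>2 \<le> f xbar" for k
    using xmin[of xbar "r k"] \<delta> feas d0[of xbar] by (simp add: F_def)
  have "(d l)\<^sup>2 \<le> 0"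
  proof (rule LIMSEQ_le)
    show "(\<lambda>k. (d (x (r k)))\<^sup>2) \<longlonglongrightarrow> (d l)\<^sup>2"
      by (intro tendsto_intros lim_d)
    have "(\<lambda>k. (2 * (f xbar - f (x (r k)))) * inverse (real (r k))) \<longlonglongrightarrow> (2 * (f xbar - f l)) * 0"
      by (intro tendsto_mult tendsto_intros lim_f tendsto_inverse_0_at_top
          filterlim_compose[OF filterlim_real_sequentially] filterlim_subseq r)
    then show "(\<lambda>k. (2 * (f xbar - f (x (r k)))) * inverse (real (r k))) \<longlonglongrightarrow> 0"
      by simp
    show "\<exists>N. \<forall>k\<ge>N. (d (x (r k)))\<^sup>2 \<le> (2 * (f xbar - f (x (r k)))) * inverse (real (r k))"
    proof (intro exI allI impI)
      \<comment> \<open>Starting at 1 makes the weight \<open>r k \<ge> k\<close> positive, so that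
        it can be divided by.\<close>
      fix k :: nat assume "1 \<le> k"
      then have "0 < r k"
        using seq_suble[OF r, of k] by simp
      moreover have "real (r k) * (d (x (r k)))\<^sup>2 \<le> 2 * (f xbar - f (x (r k)))"
      proof -
        have "n * D \<le> 2 * (b - a)" if "a + q / 2 + n / 2 * D \<le> b" "0 \<le> q" for a b q n D :: real
          using that by (simp add: field_simps)
        from this[OF bound zero_le_power2] show ?thesis .
      qed
      ultimately show "(d (x (r k)))\<^sup>2 \<le> (2 * (f xbar - f (x (r k)))) * inverse (real (r k))"
        by (simp add: field_simps)
    qed
  qed
  then have "psd (G l)"
    using d0 by simp
  moreover have "l \<in> ball xbar \<epsilon>"
    using l \<epsilon> by (simp add: \<delta>_def)
  ultimately have "f xbar \<le> f l"
    by (rule loc)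
  moreover have "f l + (dist l xbar)\<^sup>2 / 2 \<le> f xbar"
  proof (rule LIMSEQ_le_const2)
    show "(\<lambda>k. f (x (r k)) + (dist (x (r k)) xbar)\<^sup>2 / 2) \<longlonglongrightarrow> f l + (dist l xbar)\<^sup>2 / 2"
      by (intro tendsto_intros lim_f lim_dist) auto
    have "0 \<le> real (r k) / 2 * (d (x (r k)))\<^sup>2" for k by simp
    then show "\<exists>N. \<forall>k\<ge>N. f (x (r k)) + (dist (x (r k)) xbar)\<^sup>2 / 2 \<le> f xbar"
      using bound by (smt (verit))
  qed
  ultimately have "(dist l xbar)\<^sup>2 \<le> 0"
    by linarith
  then have "l = xbar" by simp
  show thesis
  proof (rule that[OF \<delta>, of "\<lambda>k. real (r k)" "x \<circ> r"])
    show "(x \<circ> r) \<longlonglongrightarrow> xbar"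
      using lim \<open>l = xbar\<close> by simp
  qed (use xmin in \<open>auto simp: F_def d_def\<close>)
qed

text \<open>
  The projections \<open>P k\<close> of \<open>G (x k)\<close> are kept along with the multipliers \<open>Y k\<close>: complementarity holds
  exactly for them and only in the limit for \<open>G (x k)\<close>.
\<close>

lemma approximate_multipliers:
  fixes f :: "real^'n \<Rightarrow> real" and G :: "real^'n \<Rightarrow> real^'m^'m"
  assumes f: "continuously_differentiable f" and G: "continuously_differentiable G"
    and sym: "\<And>x. symmetric_matrix (G x)" and min: "local_minimizer f G xbar"
  obtains x Y P where "x \<longlonglongrightarrow> xbar" "\<And>k. psd (Y k)" "P \<longlonglongrightarrow> G xbar" "\<And>k. Y k ** P k = 0"
    "\<And>k. gradient f (x k) + (x k - xbar) = adjoint_derivative G (x k) (Y k)"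
    "\<And>k e c. G (x k) *v e = c *\<^sub>R e \<Longrightarrow> norm e = 1 \<Longrightarrow> Y k *v e = (e \<bullet> (Y k *v e)) *\<^sub>R e"
proof (rule penalty_minimizers[OF f[THEN continuously_differentiable_continuous]
      G[THEN continuously_differentiable_continuous] min])
  fix x0 :: "nat \<Rightarrow> real^'n" and \<rho>0 :: "nat \<Rightarrow> real" and \<delta> :: real
  assume \<delta>: "0 < \<delta>" and \<rho>0: "\<And>k. 0 \<le> \<rho>0 k" and x0: "x0 \<longlonglongrightarrow> xbar"
    and min0: "\<And>k y. y \<in> cball xbar \<delta> \<Longrightarrow>
      f (x0 k) + (dist (x0 k) xbar)\<^sup>2 / 2 + \<rho>0 k / 2 * (infdist (G (x0 k)) {M. psd M})\<^sup>2 \<le>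
      f y + (dist y xbar)\<^sup>2 / 2 + \<rho>0 k / 2 * (infdist (G y) {M. psd M})\<^sup>2"
  \<comment> \<open>Discarding the first \<open>N\<close> terms puts every point in the open ball,
    so that each is an unconstrained local minimizer of its penalty function.\<close>
  obtain N where N: "\<And>k. k \<ge> N \<Longrightarrow> dist (x0 k) xbar < \<delta>"
    using x0 \<delta> by (metis lim_sequentially)
  define x \<rho> where "x k = x0 (k + N)" and "\<rho> k = \<rho>0 (k + N)" for k
  have x: "x \<longlonglongrightarrow> xbar"
    unfolding x_def using x0 by (rule LIMSEQ_ignore_initial_segment)
  have xball: "x k \<in> ball xbar \<delta>" for k
    using N[of "k + N"] by (simp add: x_def dist_commute)
  have "\<exists>P. psd P \<and> dist (G (x k)) P = infdist (G (x k)) {M. psd M} \<and>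
      psd (P - G (x k)) \<and> (P - G (x k)) ** P = 0" for k
    using psd_projection[OF sym] by metis
  then obtain P where P: "\<And>k. psd (P k)" "\<And>k. dist (G (x k)) (P k) = infdist (G (x k)) {M. psd M}"
      "\<And>k. psd (P k - G (x k))" "\<And>k. (P k - G (x k)) ** P k = 0"
    by metis
  define Y where "Y k = \<rho> k *\<^sub>R (P k - G (x k))" for k
  have limG: "(\<lambda>k. G (x k)) \<longlonglongrightarrow> G xbar"
    using continuous_on_tendsto_compose[OF continuously_differentiable_continuous[OF G, of UNIV] x] by simp
  have psdY: "psd (Y k)" for k
    unfolding Y_def by (intro psd_scaleR P) (simp add: \<rho>_def \<rho>0)
  have limP: "P \<longlonglongrightarrow> G xbar"
  proof -
    have "psd (G xbar)"
      using min by (simp add: local_minimizer_def feasible_set_def)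
    have "(\<lambda>k. infdist (G (x k)) {M. psd M}) \<longlonglongrightarrow> infdist (G xbar) {M. psd M}"
      by (intro tendsto_intros limG)
    also have "infdist (G xbar) {M. psd M} = 0"
      using \<open>psd (G xbar)\<close> by (simp add: infdist_zero)
    \<comment> \<open>The norm is the distance from \<open>G (x k)\<close> to the cone, which tends
      to that of the feasible value \<open>G xbar\<close>.\<close>
    finally have "(\<lambda>k. norm (G (x k) - P k)) \<longlonglongrightarrow> 0"
      unfolding P(2)[symmetric] dist_norm .
    from tendsto_diff[OF limG tendsto_norm_zero_cancel[OF this]] show ?thesis
      by simp
  qed
  have stat: "gradient f (x k) + (x k - xbar) = adjoint_derivative G (x k) (Y k)" for k
    unfolding Y_def
  proof (rule penalty_stationary[OF f G])
    show "symmetric_matrix (P k - G (x k))"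
      using P(3) by (simp add: psd_def)
    \<comment> \<open>For every \<open>y\<close>, the distance to \<open>P k\<close> dominates the
      distance to the cone, with equality at \<open>x k\<close>; hence \<open>x k\<close> also
      minimizes the smooth majorant.\<close>
    have "f (x k) + (dist (x k) xbar)\<^sup>2 / 2 + \<rho> k / 2 * (dist (G (x k)) (P k))\<^sup>2 \<le>
        f y + (dist y xbar)\<^sup>2 / 2 + \<rho> k / 2 * (dist (G y) (P k))\<^sup>2" if "y \<in> ball xbar \<delta>" for y
    proof -
      have "infdist (G y) {M. psd M} \<le> dist (G y) (P k)"
        using P(1) by (intro infdist_le) simp
      then have "\<rho> k / 2 * (infdist (G y) {M. psd M})\<^sup>2 \<le> \<rho> k / 2 * (dist (G y) (P k))\<^sup>2"
        by (intro mult_left_mono power_mono infdist_nonneg) (simp_all add: \<rho>_def \<rho>0)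
      moreover have "y \<in> cball xbar \<delta>"
        using that by simp
      ultimately show ?thesis
        using min0[of y "k + N"] unfolding P(2) unfolding x_def \<rho>_def by linarith
    qed
    then show "eventually (\<lambda>y. f (x k) + (dist (x k) xbar)\<^sup>2 / 2 + \<rho> k / 2 * (dist (G (x k)) (P k))\<^sup>2 \<le>
        f y + (dist y xbar)\<^sup>2 / 2 + \<rho> k / 2 * (dist (G y) (P k))\<^sup>2) (at (x k))"
      unfolding eventually_at_topological using xball[of k] open_ball by blast
  qed
  have eig: "Y k *v e = (e \<bullet> (Y k *v e)) *\<^sub>R e" if "G (x k) *v e = c *\<^sub>R e" "norm e = 1" for k e c
  proof -
    have "(P k - G (x k)) *v e = (e \<bullet> ((P k - G (x k)) *v e)) *\<^sub>R e"
      by (rule eigenvector_of_psd_part[OF P(1,3,4), where c = c]) (use that in simp_all)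
    then show ?thesis
      unfolding Y_def by (metis inner_scaleR_right scaleR_matrix_vector_assoc scaleR_scaleR)
  qed
  have "Y k ** P k = 0" for k
    using P(4)[of k] by (simp add: Y_def scalar_matrix_assoc[symmetric])
  from that[OF x psdY limP this stat eig] show thesis .
qed

section \<open>Limits of the normalized multipliers\<close>

lemma weak_cq_mono:
  assumes "\<And>p w. I p w \<Longrightarrow> J p w" and "weak_cq I G xbar"
  shows "weak_cq J G xbar"
  using assms(2) unfolding weak_cq_def Let_def by (meson assms(1))

lemma weak_nondegeneracy_imp_weak_Robinson:
  "weak_nondegeneracy G xbar \<Longrightarrow> weak_Robinson G xbar"
  unfolding weak_nondegeneracy_def weak_Robinson_def
  by (erule weak_cq_mono[rotated]) (simp add: lin_indep_family_def pos_lin_indep_family_def)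

text \<open>
  The subsequence must be fixed before that of the multipliers, as the constraint qualification
  provides \<open>Ebar\<close> only along one subsequence.
\<close>

lemma weak_Robinson_singular_multiplier:
  fixes G :: "real^'n \<Rightarrow> real^'m^'m"
  assumes G: "continuously_differentiable G" and sym: "\<And>x. symmetric_matrix (G x)"
    and cq: "weak_Robinson G xbar" and x: "x \<longlonglongrightarrow> xbar"
  shows "\<exists>\<phi> :: nat \<Rightarrow> nat. strict_mono \<phi> \<and> (\<forall>r Z W. strict_mono r \<longrightarrow> (\<forall>k. psd (Z k)) \<longrightarrow> Z \<longlonglongrightarrow> W \<longrightarrow>
    (\<forall>k e c. G (x (\<phi> (r k))) *v e = c *\<^sub>R e \<longrightarrow> norm e = 1 \<longrightarrow> Z k *v e = (e \<bullet> (Z k *v e)) *\<^sub>R e) \<longrightarrow>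
    W ** G xbar = 0 \<longrightarrow> adjoint_derivative G xbar W = 0 \<longrightarrow> W = 0)"
proof -
  define p where "p = CARD('m) - rank (G xbar)"
  have feas: "psd (G xbar)"
    using cq by (simp add: weak_Robinson_def weak_cq_def feasible_set_def)
  \<comment> \<open>Transposing \<open>W ** G xbar = 0\<close> shows that the range of
    \<open>W\<close> lies in the kernel of \<open>G xbar\<close>.\<close>
  have ker: "G xbar *v (W *v v) = 0" if "symmetric_matrix W" "W ** G xbar = 0" for W v
  proof -
    have "G xbar ** W = 0"
      by (metis that sym matrix_transpose_mul symmetric_matrix_def psd_0 psd_def)
    then show ?thesis
      by (simp add: matrix_vector_mul_assoc)
  qed
  consider "{v. G xbar *v v = 0} = {0}" | "\<exists>E :: nat \<Rightarrow> nat \<Rightarrow> real^'m.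
      (\<forall>k. orthonormal_columns p (E k)) \<and> (\<forall>k. smallest_eigenvectors (G (x k)) p (E k)) \<and>
      (\<exists>Ebar \<phi>. strict_mono \<phi> \<and> (\<forall>i<p. (\<lambda>k. E (\<phi> k) i) \<longlonglongrightarrow> Ebar i) \<and>
        pos_lin_indep_family p (\<lambda>i. v_vec G xbar Ebar i i))"
    using cq x unfolding weak_Robinson_def weak_cq_def Let_def p_def by blast
  then show ?thesis
  proof cases
    case 1
    \<comment> \<open>With a trivial kernel \<open>W\<close> vanishes outright, so the identity
      serves as subsequence.\<close>
    have zero: "W = 0" if "\<And>k. psd (Z k)" "Z \<longlonglongrightarrow> W" "W ** G xbar = 0" for Z and W :: "real^'m^'m"
    proof -
      have "symmetric_matrix W"
        using psd_limit[OF that(1,2)] by (simp add: psd_def)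
      then have "W *v v = 0" for v
        using ker[OF _ that(3), of v] 1 by blast
      then show ?thesis
        by (simp add: matrix_eq)
    qed
    show ?thesis
      by (intro exI[of _ "id :: nat \<Rightarrow> nat"] conjI allI impI strict_mono_id) (rule zero; blast)
  next
    case 2
    then obtain E :: "nat \<Rightarrow> nat \<Rightarrow> real^'m" and Ebar \<phi> where on: "\<And>k. orthonormal_columns p (E k)"
      and sm: "\<And>k. smallest_eigenvectors (G (x k)) p (E k)"
      and \<phi>: "strict_mono \<phi>" and lim: "\<And>i. i < p \<Longrightarrow> (\<lambda>k. E (\<phi> k) i) \<longlonglongrightarrow> Ebar i"
      and indep: "pos_lin_indep_family p (\<lambda>i. v_vec G xbar Ebar i i)"
      by blast
    have "W = 0" if r: "strict_mono r" and psdZ: "\<And>k. psd (Z k)" and Z: "Z \<longlonglongrightarrow> W"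
      and eig: "\<And>k e c. G (x (\<phi> (r k))) *v e = c *\<^sub>R e \<Longrightarrow> norm e = 1 \<Longrightarrow>
        Z k *v e = (e \<bullet> (Z k *v e)) *\<^sub>R e"
      and WG: "W ** G xbar = 0" and adj: "adjoint_derivative G xbar W = 0" for r Z W
    proof -
      have psdW: "psd W" and symW: "symmetric_matrix W"
        using psd_limit[OF psdZ Z] by (simp_all add: psd_def)
      define \<alpha> where "\<alpha> i = Ebar i \<bullet> (W *v Ebar i)" for i
      have \<phi>r: "strict_mono (\<phi> \<circ> r)"
        using \<phi> r by (rule strict_mono_o)
      have limE: "(\<lambda>k. E (\<phi> (r k)) i) \<longlonglongrightarrow> Ebar i" if "i < p" for i
        using LIMSEQ_subseq_LIMSEQ[OF lim[OF that] r] by (simp add: o_def)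
      have limG: "(\<lambda>k. G (x (\<phi> (r k)))) \<longlonglongrightarrow> G xbar"
        using continuous_on_tendsto_compose[OF continuously_differentiable_continuous[OF G, of UNIV]
            LIMSEQ_subseq_LIMSEQ[OF x \<phi>r]] by (simp add: o_def)
      have eigW: "W *v Ebar i = \<alpha> i *\<^sub>R Ebar i" if i: "i < p" for i
      proof -
        have "Z k *v E (\<phi> (r k)) i = (E (\<phi> (r k)) i \<bullet> (Z k *v E (\<phi> (r k)) i)) *\<^sub>R E (\<phi> (r k)) i" for k
        proof -
          have "norm (E (\<phi> (r k)) i) = 1"
            using on i by (simp add: orthonormal_columns_def norm_eq_1)
          moreover obtain c where "G (x (\<phi> (r k))) *v E (\<phi> (r k)) i = c *\<^sub>R E (\<phi> (r k)) i"
            using sm i unfolding smallest_eigenvectors_def by blast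
          ultimately show ?thesis
            using eig by blast
        qed
        moreover have "(\<lambda>k. Z k *v E (\<phi> (r k)) i) \<longlonglongrightarrow> W *v Ebar i"
          by (intro tendsto_matrix_vector_mult Z limE i)
        moreover have "(\<lambda>k. (E (\<phi> (r k)) i \<bullet> (Z k *v E (\<phi> (r k)) i)) *\<^sub>R E (\<phi> (r k)) i) \<longlonglongrightarrow> \<alpha> i *\<^sub>R Ebar i"
          unfolding \<alpha>_def by (intro tendsto_intros tendsto_matrix_vector_mult Z limE i)
        ultimately show ?thesis
          by (metis (no_types, lifting) LIMSEQ_unique ext)
      qed
      define Q :: "nat \<Rightarrow> real^'m^'m" where "Q i = (\<chi> a b. Ebar i $ a * Ebar i $ b)" for i
      have Qv: "Q i *v v = (Ebar i \<bullet> v) *\<^sub>R Ebar i" for i v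
        by (simp add: Q_def outer_product_vector_mult)
      \<comment> \<open>Spectral decomposition of \<open>W\<close>: each \<open>W *v v\<close> is a
        kernel vector of \<open>G xbar\<close>, hence expands in the limiting columns, which are
        eigenvectors of \<open>W\<close>.\<close>
      have W: "W = (\<Sum>i<p. \<alpha> i *\<^sub>R Q i)"
      proof (rule matrix_eq[THEN iffD2], rule allI)
        fix v
        have "W *v v = (\<Sum>i<p. (Ebar i \<bullet> (W *v v)) *\<^sub>R Ebar i)"
          by (rule limit_smallest_eigenvectors_kernel[OF sym limG feas p_def on sm limE ker[OF symW WG]])
        also have "\<dots> = (\<Sum>i<p. (\<alpha> i *\<^sub>R Q i) *v v)"
          by (intro sum.cong)
            (simp_all add: symmetric_matrix_inner[OF symW, symmetric] eigW Qv scaleR_matrix_vector_assoc[symmetric])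
        also have "\<dots> = (\<Sum>i<p. \<alpha> i *\<^sub>R Q i) *v v"
          by (induction p) (simp_all add: matrix_vector_mult_add_rdistrib)
        finally show "W *v v = (\<Sum>i<p. \<alpha> i *\<^sub>R Q i) *v v" .
      qed
      \<comment> \<open>Pairing a partial derivative with \<open>Q i\<close> gives a component of
        \<open>v_vec G xbar Ebar i i\<close>, so this sum is the adjoint derivative applied to
        \<open>W\<close>.\<close>
      have "(\<Sum>i<p. \<alpha> i *\<^sub>R v_vec G xbar Ebar i i) = 0"
      proof (rule vec_eq_iff[THEN iffD2], rule allI)
        fix l
        have "(\<Sum>i<p. \<alpha> i *\<^sub>R v_vec G xbar Ebar i i) $ l =
            (\<Sum>i<p. \<alpha> i * (partial_derivative l G xbar \<bullet> Q i))"
          by (simp add: v_vec_def Q_def inner_outer_product)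
        also have "\<dots> = trace_inner (partial_derivative l G xbar) W"
          unfolding trace_inner_symmetric[OF symW] by (simp add: W inner_sum_right)
        also have "\<dots> = 0"
          using adj by (simp add: adjoint_derivative_def vec_eq_iff)
        finally show "(\<Sum>i<p. \<alpha> i *\<^sub>R v_vec G xbar Ebar i i) $ l = 0 $ l"
          by simp
      qed
      moreover have "0 \<le> \<alpha> i" for i
        using psdW by (simp add: \<alpha>_def psd_def)
      ultimately have "\<forall>i<p. \<alpha> i = 0"
        using indep by (simp add: pos_lin_indep_family_def)
      then show "W = 0"
        by (simp add: W)
    qed
    with \<phi> show ?thesis
      by (intro exI[of _ \<phi>]) blast
  qed
qed

lemma weak_Robinson_imp_KKT:
  fixes f :: "real^'n \<Rightarrow> real" and G :: "real^'n \<Rightarrow> real^'m^'m"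
  assumes f: "continuously_differentiable f" and G: "continuously_differentiable G"
    and sym: "\<And>x. symmetric_matrix (G x)"
    and min: "local_minimizer f G xbar" and cq: "weak_Robinson G xbar"
  shows "KKT f G xbar"
proof (rule approximate_multipliers[OF f G sym min])
  fix x :: "nat \<Rightarrow> real^'n" and Y P :: "nat \<Rightarrow> real^'m^'m"
  assume x: "x \<longlonglongrightarrow> xbar" and psdY: "\<And>k. psd (Y k)" and P: "P \<longlonglongrightarrow> G xbar"
    and YP: "\<And>k. Y k ** P k = 0"
    and stat: "\<And>k. gradient f (x k) + (x k - xbar) = adjoint_derivative G (x k) (Y k)"
    and eig: "\<And>k e c. G (x k) *v e = c *\<^sub>R e \<Longrightarrow> norm e = 1 \<Longrightarrow> Y k *v e = (e \<bullet> (Y k *v e)) *\<^sub>R e"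
  \<comment> \<open>This scaling keeps the multipliers bounded while \<open>s k + norm (Z k)\<close>
    stays exactly 1, so their limits cannot both vanish.\<close>
  define s where "s k = 1 / (1 + norm (Y k))" for k
  define Z where "Z k = s k *\<^sub>R Y k" for k
  have s_pos: "0 < s k" and sZ: "s k + norm (Z k) = 1" for k
  proof -
    have pos: "0 < 1 + norm (Y k)"
      by (simp add: add_pos_nonneg)
    then show "0 < s k" by (simp add: s_def)
    show "s k + norm (Z k) = 1"
      using pos by (simp add: Z_def s_def add_divide_distrib[symmetric])
  qed
  obtain \<phi> :: "nat \<Rightarrow> nat" where \<phi>: "strict_mono \<phi>"
    and sing: "\<And>r Z W. strict_mono r \<Longrightarrow> (\<And>k. psd (Z k)) \<Longrightarrow> Z \<longlonglongrightarrow> W \<Longrightarrow>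
      (\<And>k e c. G (x (\<phi> (r k))) *v e = c *\<^sub>R e \<Longrightarrow> norm e = 1 \<Longrightarrow> Z k *v e = (e \<bullet> (Z k *v e)) *\<^sub>R e) \<Longrightarrow>
      W ** G xbar = 0 \<Longrightarrow> adjoint_derivative G xbar W = 0 \<Longrightarrow> W = 0"
    using weak_Robinson_singular_multiplier[OF G sym cq x] by blast
  have "(s (\<phi> k), Z (\<phi> k)) \<in> {0..1} \<times> cball 0 1" for k
    using s_pos[of "\<phi> k"] sZ[of "\<phi> k"] norm_ge_zero[of "Z (\<phi> k)"] by (simp del: norm_ge_zero)
  moreover have "seq_compact ({0..1::real} \<times> cball (0::real^'m^'m) 1)"
    by (intro compact_imp_seq_compact compact_Times) auto
  ultimately obtain tW r where r: "strict_mono r" and limq: "((\<lambda>k. (s (\<phi> k), Z (\<phi> k))) \<circ> r) \<longlonglongrightarrow> tW"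
    using seq_compactE[of "{0..1} \<times> cball 0 1" "\<lambda>k. (s (\<phi> k), Z (\<phi> k))" thesis] by blast
  have lims: "(\<lambda>k. s (\<phi> (r k))) \<longlonglongrightarrow> fst tW" and limZ: "(\<lambda>k. Z (\<phi> (r k))) \<longlonglongrightarrow> snd tW"
    using tendsto_fst[OF limq] tendsto_snd[OF limq] by (simp_all add: o_def)
  define t W where "t = fst tW" and "W = snd tW"
  note lims = lims[folded t_def] and limZ = limZ[folded W_def]
  have \<phi>r: "strict_mono (\<phi> \<circ> r)"
    using \<phi> r by (rule strict_mono_o)
  have limx: "(\<lambda>k. x (\<phi> (r k))) \<longlonglongrightarrow> xbar" and limP: "(\<lambda>k. P (\<phi> (r k))) \<longlonglongrightarrow> G xbar"
    using LIMSEQ_subseq_LIMSEQ[OF x \<phi>r] LIMSEQ_subseq_LIMSEQ[OF P \<phi>r] by (simp_all add: o_def)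
  have psdZ: "psd (Z k)" for k
    unfolding Z_def using s_pos[of k] by (intro psd_scaleR psdY) simp
  have psdW: "psd W"
    by (rule psd_limit[OF _ limZ]) (rule psdZ)
  \<comment> \<open>The exact relation \<open>Y k ** P k = 0\<close> passes to the limit because
    \<open>P k\<close> tends to \<open>G xbar\<close>.\<close>
  have WG: "W ** G xbar = 0"
  proof -
    have "(\<lambda>k. Z (\<phi> (r k)) ** P (\<phi> (r k))) \<longlonglongrightarrow> W ** G xbar"
      by (intro tendsto_matrix_matrix_mult limZ limP)
    moreover have "Z k ** P k = 0" for k
      using YP[of k] by (simp add: Z_def scalar_matrix_assoc[symmetric])
    ultimately show ?thesis
      by (simp add: LIMSEQ_const_iff)
  qed
  have adjW: "t *\<^sub>R gradient f xbar = adjoint_derivative G xbar W"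
  proof (rule LIMSEQ_unique)
    have "(\<lambda>k. s (\<phi> (r k)) *\<^sub>R (gradient f (x (\<phi> (r k))) + (x (\<phi> (r k)) - xbar))) \<longlonglongrightarrow>
        t *\<^sub>R (gradient f xbar + (xbar - xbar))"
      by (intro tendsto_intros lims limx tendsto_gradient f)
    then show "(\<lambda>k. adjoint_derivative G (x (\<phi> (r k))) (Z (\<phi> (r k)))) \<longlonglongrightarrow> t *\<^sub>R gradient f xbar"
      by (simp add: stat Z_def adjoint_derivative_scaleR)
    show "(\<lambda>k. adjoint_derivative G (x (\<phi> (r k))) (Z (\<phi> (r k)))) \<longlonglongrightarrow> adjoint_derivative G xbar W"
      by (rule tendsto_adjoint_derivative[OF G limx limZ])
  qed
  have tW: "t + norm W = 1"
  proof (rule LIMSEQ_unique)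
    show "(\<lambda>k. s (\<phi> (r k)) + norm (Z (\<phi> (r k)))) \<longlonglongrightarrow> t + norm W"
      by (intro tendsto_intros lims limZ)
  qed (simp add: sZ)
  have "t \<noteq> 0"
  proof
    assume "t = 0"
    have "W = 0"
    proof (rule sing[OF r _ limZ _ WG])
      show "adjoint_derivative G xbar W = 0"
        using adjW \<open>t = 0\<close> by simp
      fix k e c assume "G (x (\<phi> (r k))) *v e = c *\<^sub>R e" "norm e = 1"
      from eig[OF this] show "Z (\<phi> (r k)) *v e = (e \<bullet> (Z (\<phi> (r k)) *v e)) *\<^sub>R e"
        unfolding Z_def by (metis inner_scaleR_right scaleR_matrix_vector_assoc scaleR_scaleR)
    qed (rule psdZ)
    with tW \<open>t = 0\<close> show False by simp
  qed
  moreover have "0 \<le> t"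
    using lims by (rule LIMSEQ_le_const) (use s_pos less_imp_le in blast)
  ultimately have t: "0 < t" by simp
  show ?thesis
    unfolding KKT_def
  proof (intro conjI exI)
    show "xbar \<in> feasible_set G"
      using min by (simp add: local_minimizer_def)
    \<comment> \<open>Since \<open>t > 0\<close>, undoing the normalization in the limit yields the
      KKT multiplier.\<close>
    show "psd ((1 / t) *\<^sub>R W)"
      using t by (intro psd_scaleR psdW) simp
    show "gradient f xbar - adjoint_derivative G xbar ((1 / t) *\<^sub>R W) = 0"
      using t by (simp add: adjoint_derivative_scaleR adjW[symmetric])
    show "trace_inner (G xbar) ((1 / t) *\<^sub>R W) = 0"
      unfolding trace_inner_def trace_mul_sym[of "G xbar"]
      by (simp add: scalar_matrix_assoc[symmetric] WG trace_def)
  qed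
qed

theorem theorem3p2:
  fixes f :: "real^'n \<Rightarrow> real" and G :: "real^'n \<Rightarrow> real^'m^'m"
  assumes "continuously_differentiable f"
    and "continuously_differentiable G"
    and "\<forall>x. symmetric_matrix (G x)"
  shows "(\<forall>xbar. local_minimizer f G xbar \<and> weak_Robinson G xbar \<longrightarrow> KKT f G xbar) \<and>
         (\<forall>xbar. local_minimizer f G xbar \<and> weak_nondegeneracy G xbar \<longrightarrow> KKT f G xbar)"
  using weak_Robinson_imp_KKT[OF assms(1,2)] weak_nondegeneracy_imp_weak_Robinson assms(3) by blast

end
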